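(* For a positive integer $n$ let $F(n)=\sum_{k=1}^{n}\frac{(k,n)}{[k,n]}$. Then, as $x\to\infty$, $$\sum_{n\le x}F(n)=2x+O\left((\log x)^2\right),$$ and $$\sum_{m,n\le x}\frac{(m,n)}{[m,n]}=3x+O\left((\log x)^2\right).$$
   Context: $(a,b)$ and $[a,b]$ denote the greatest common divisor and least common multiple of positive integers $a,b$; sums range over positive integers. *)

theory Defs
  imports "HOL-Analysis.Analysis" "HOL-Library.Landau_Symbols"
begin

definition F :: "nat \<Rightarrow> real" where
  "F n = (\<Sum>k = 1..n. real (gcd k n) / real (lcm k n))"

end

(* Write d = gcd(k, n), k = d a, n = d b: the summand is 1 / (a b), so F(n) is the sum of G(b) / b over b | n,
   where G(b) is the sum of 1 / a over the a <= b coprime to b.  Summing over n <= N gives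
   sum_b floor(N / b) G(b) / b, which is N * sum_b G(b) / b^2 up to O((log N)^2).  The value 2 of the series
   comes from H_n = sum_{d | n} G(n / d) / d, that is, sum_n H_n / n^2 = zeta(3) * sum_b G(b) / b^2, together with
   Euler's evaluation sum_n H_n / n^2 = 2 zeta(3).  By symmetry, the sum over pairs is twice the sum of F,
   less the diagonal. *)
theory Submission
  imports Defs
begin

section \<open>Finite identities and bounds: gcd classes, divisor sums, a telescoping
  estimate\<close>

definition coprime_harm :: "nat \<Rightarrow> real" where
  "coprime_harm n = (\<Sum>k | k \<in> {1..n} \<and> coprime k n. 1 / real k)"

lemma coprime_harm_nonneg: "coprime_harm n \<ge> 0"
  unfolding coprime_harm_def by (intro sum_nonneg) auto

lemma coprime_harm_le_harm: "coprime_harm n \<le> harm n"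
  unfolding coprime_harm_def harm_def divide_inverse by (simp, intro sum_mono2) auto

text \<open>Each \<open>k\<close> in \<open>{1..n}\<close> is \<open>d * a\<close> for exactly one
  \<open>d\<close> dividing \<open>n\<close> and one \<open>a\<close> coprime to
  \<open>n div d\<close>, namely with d = gcd(k, n). The function \<open>f\<close> is arbitrary
  because the same grouping serves both \<open>F\<close> and the harmonic numbers.\<close>

lemma sum_by_gcd:
  fixes f :: "nat \<Rightarrow> 'a :: comm_monoid_add"
  assumes "n > 0"
  shows "(\<Sum>k=1..n. f k) =
    (\<Sum>d | d dvd n. \<Sum>a | a \<in> {1..n div d} \<and> coprime a (n div d). f (d * a))"
proof -
  have "(\<Sum>d | d dvd n. \<Sum>a | a \<in> {1..n div d} \<and> coprime a (n div d). f (d * a)) =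
        (\<Sum>(d, a) \<in> (SIGMA d:{d. d dvd n}. {a \<in> {1..n div d}. coprime a (n div d)}). f (d * a))"
    using assms by (intro sum.Sigma) auto
  also have "\<dots> = (\<Sum>k=1..n. f k)"
  proof (rule sum.reindex_bij_witness[of _ "\<lambda>k. (gcd k n, k div gcd k n)" "\<lambda>(d, a). d * a"], goal_cases)
    case (1 x)
    then obtain d a where x: "x = (d, a)" "d dvd n" "a \<ge> 1" "coprime a (n div d)" by auto
    from \<open>d dvd n\<close> obtain b where "n = d * b" ..
    with x assms have "gcd (d * a) n = d" by (auto simp: gcd_mult_left)
    with x assms show ?case by (simp add: dvd_pos_nat)
  next
    case (2 x)
    then obtain d a where x: "x = (d, a)" "d dvd n" "a \<ge> 1" "a \<le> n div d" by auto
    from \<open>d dvd n\<close> obtain b where "n = d * b" ..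
    with x assms have "d * a \<le> n" by auto
    with x assms show ?case by (auto dest: dvd_pos_nat)
  next
    case (4 k)
    then have "k div gcd k n > 0" by (simp add: div_greater_zero_iff gcd_le1_nat)
    moreover have "k div gcd k n \<le> n div gcd k n" using 4 by (simp add: div_le_mono)
    moreover have "coprime (k div gcd k n) (n div gcd k n)" using assms by (intro div_gcd_coprime) simp
    ultimately show ?case by simp
  qed auto
  finally show ?thesis ..
qed

lemma F_eq_sum_divisors:
  assumes "n > 0"
  shows "F n = (\<Sum>b | b dvd n. coprime_harm b / real b)"
proof -
  have "F n = (\<Sum>d | d dvd n. \<Sum>a | a \<in> {1..n div d} \<and> coprime a (n div d).
      real (gcd (d * a) n) / real (lcm (d * a) n))"
    unfolding F_def using assms by (rule sum_by_gcd)
  also have "\<dots> = (\<Sum>d | d dvd n. coprime_harm (n div d) / real (n div d))"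
    unfolding coprime_harm_def sum_divide_distrib
  proof (intro sum.cong refl, clarify)
    fix d a assume da: "d dvd n" "a \<in> {1..n div d}" "coprime a (n div d)"
    then obtain b where n: "n = d * b" by auto
    with assms have "d > 0" "b > 0" by auto
    with da n have "gcd (d * a) n = d" "lcm (d * a) n = d * (a * b)"
      by (auto simp: gcd_mult_left lcm_mult_left lcm_coprime)
    then show "real (gcd (d * a) n) / real (lcm (d * a) n) = 1 / real a / real (n div d)"
      using \<open>d > 0\<close> n by simp
  qed
  also have "\<dots> = (\<Sum>b | b dvd n. coprime_harm b / real b)"
    using assms by (intro sum.reindex_bij_witness[of _ "\<lambda>b. n div b" "\<lambda>b. n div b"]) auto
  finally show ?thesis .
qed

text \<open>Same classes as for \<open>F\<close>, but the weight 1 / (d * a) keeps its factor 1 / d: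
  the harmonic number is the Dirichlet convolution of 1 / d with
  \<open>coprime_harm\<close>.\<close>

lemma harm_eq_sum_divisors:
  assumes "n > 0"
  shows "harm n = (\<Sum>d | d dvd n. coprime_harm (n div d) / real d)"
proof -
  have "harm n = (\<Sum>k=1..n. 1 / real k)"
    by (simp add: harm_def divide_inverse)
  also have "\<dots> = (\<Sum>d | d dvd n. \<Sum>a | a \<in> {1..n div d} \<and> coprime a (n div d). 1 / real (d * a))"
    using assms by (rule sum_by_gcd)
  also have "\<dots> = (\<Sum>d | d dvd n. coprime_harm (n div d) / real d)"
    unfolding coprime_harm_def sum_divide_distrib by (intro sum.cong) (auto simp: field_simps)
  finally show ?thesis .
qed

text \<open>After interchanging the sums, each \<open>b\<close> is counted once for every multiple
  of \<open>b\<close> up to \<open>N\<close>.\<close>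

lemma sum_F_eq:
  "(\<Sum>n=1..N. F n) = (\<Sum>b=1..N. coprime_harm b / real b * real (N div b))"
proof -
  \<comment> \<open>Moving the divisibility condition into the summand makes the index set a square,
    so that the sums can be swapped.\<close>
  have "(\<Sum>n=1..N. F n) = (\<Sum>n=1..N. \<Sum>b=1..N. if b dvd n then coprime_harm b / real b else 0)"
  proof (intro sum.cong refl)
    fix n assume n: "n \<in> {1..N}"
    then have "{b. b dvd n} = {b \<in> {1..N}. b dvd n}"
      by (auto simp: Suc_le_eq dvd_pos_nat intro: order_trans[OF dvd_imp_le])
    with n show "F n = (\<Sum>b=1..N. if b dvd n then coprime_harm b / real b else 0)"
      by (simp add: F_eq_sum_divisors flip: sum.inter_filter)
  qed
  also have "\<dots> = (\<Sum>b=1..N. \<Sum>n=1..N. if b dvd n then coprime_harm b / real b else 0)"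
    by (rule sum.swap)
  also have "\<dots> = (\<Sum>b=1..N. coprime_harm b / real b * real (N div b))"
  proof (intro sum.cong refl)
    fix b assume b: "b \<in> {1..N}"
    have "card {n \<in> {1..N}. b dvd n} = card {1..N div b}"
    proof (intro bij_betw_same_card[of "\<lambda>n. n div b"] bij_betw_byWitness[where f' = "\<lambda>k. b * k"])
      show "(\<lambda>n. n div b) ` {n \<in> {1..N}. b dvd n} \<subseteq> {1..N div b}"
        using b by (auto simp: div_le_mono Suc_le_eq dvd_imp_le div_greater_zero_iff)
      show "(\<lambda>k. b * k) ` {1..N div b} \<subseteq> {n \<in> {1..N}. b dvd n}"
        using b by (auto simp: less_eq_div_iff_mult_less_eq mult.commute)
    qed (use b in auto)
    with b show "(\<Sum>n=1..N. if b dvd n then coprime_harm b / real b else 0) =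
        coprime_harm b / real b * real (N div b)"
      by (simp flip: sum.inter_filter)
  qed
  finally show ?thesis .
qed

(* (H_n + 2) / n is chosen so that its decrements dominate H_n / n^2. *)
lemma sum_harm_over_square_le:
  assumes "N \<ge> 1" "N \<le> M"
  shows "(\<Sum>n=Suc N..M. harm n / (real n)\<^sup>2) \<le> (harm N + 2) / real N - (harm M + 2) / real M"
  using assms(2,1)
proof (induction rule: dec_induct)
  case (step M)
  have "harm (Suc M) / (real (Suc M))\<^sup>2 \<le> (harm M + 2) / real M - (harm (Suc M) + 2) / real (Suc M)"
  proof -
    define m h where "m = real M" and "h = (harm M :: real)"
    have m: "m \<ge> 1" "h \<ge> 0" using step by (auto simp: m_def h_def harm_nonneg)
    have "(h + 1 / (m + 1)) / (m + 1)\<^sup>2 \<le> (h + 2) / m - (h + 1 / (m + 1) + 2) / (m + 1)"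
    proof -
      \<comment> \<open>Over the common denominator the numerator collapses to h + m + 2 - m / (m +
        1), which is positive since the last fraction is at most 1.\<close>
      have "(h + 2) / m - (h + 1 / (m + 1) + 2) / (m + 1) - (h + 1 / (m + 1)) / (m + 1)\<^sup>2 =
          ((h + 2) * (m + 1)\<^sup>2 - m * (h + 2) * (m + 1) - m * (h + 1) - m / (m + 1)) / (m * (m + 1)\<^sup>2)"
        using m by (simp add: divide_simps) (simp add: algebra_simps power2_eq_square)
      moreover have "m / (m + 1) \<le> 1" using m by simp
      moreover have "(h + 2) * (m + 1)\<^sup>2 - m * (h + 2) * (m + 1) - m * (h + 1) = h + m + 2"
        by (simp add: algebra_simps power2_eq_square)
      moreover have "(h + m + 2 - m / (m + 1)) / (m * (m + 1)\<^sup>2) \<ge> 0"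
        using m \<open>m / (m + 1) \<le> 1\<close> by (intro divide_nonneg_nonneg) (linarith | simp)+
      ultimately have "(h + 2) / m - (h + 1 / (m + 1) + 2) / (m + 1) - (h + 1 / (m + 1)) / (m + 1)\<^sup>2 \<ge> 0"
        by simp
      then show ?thesis by simp
    qed
    then show ?thesis by (simp add: m_def h_def harm_Suc inverse_eq_divide add_ac)
  qed
  with step show ?case by simp
qed simp


section \<open>Convergence of the series and a tail bound\<close>

lemma summable_on_inverse_cube: "(\<lambda>n. 1 / real n ^ 3) summable_on {1..}"
proof -
  have "summable (\<lambda>n. inverse (real n ^ 3))"
    by (rule inverse_power_summable) simp
  then have "(\<lambda>n. 1 / real n ^ 3) summable_on UNIV"
    by (intro summable_nonneg_imp_summable_on) (simp_all add: inverse_eq_divide)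
  then show ?thesis by (rule summable_on_subset) simp
qed

text \<open>Arbitrary finite sets appear because unordered sums are controlled through their finite
  subsums. The case N = 1 yields summability, general \<open>N\<close> the tail bound.\<close>

lemma sum_harm_over_square_bounded:
  assumes "finite X" "X \<subseteq> {Suc N..}" "N \<ge> 1"
  shows "(\<Sum>n\<in>X. harm n / (real n)\<^sup>2) \<le> (harm N + 2) / real N"
proof -
  obtain M where M: "X \<subseteq> {..M}"
    using assms(1) by (auto simp: finite_nat_set_iff_bounded_le)
  \<comment> \<open>\<open>M\<close> may lie below \<open>N\<close> when \<open>X\<close> is empty;
    the maximum rules this out.\<close>
  define M' where "M' = max M N"
  have "(\<Sum>n\<in>X. harm n / (real n)\<^sup>2) \<le> (\<Sum>n=Suc N..M'. harm n / (real n)\<^sup>2)"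
    using M assms by (intro sum_mono2) (auto simp: M'_def harm_nonneg subset_iff le_max_iff_disj)
  also have "\<dots> \<le> (harm N + 2) / real N - (harm M' + 2) / real M'"
    using assms by (intro sum_harm_over_square_le) (auto simp: M'_def)
  also have "\<dots> \<le> (harm N + 2) / real N"
    by (simp add: harm_nonneg add_nonneg_nonneg)
  finally show ?thesis .
qed

lemma summable_on_harm_over_square: "(\<lambda>n. harm n / (real n)\<^sup>2) summable_on {1..}"
proof -
  have "(\<lambda>n. harm n / (real n)\<^sup>2) summable_on {Suc 1..}"
    using sum_harm_over_square_bounded[of _ 1]
    by (intro nonneg_bdd_above_summable_on) (auto simp: harm_nonneg intro!: bdd_aboveI2)
  \<comment> \<open>The bound divides by \<open>N\<close>, so it starts at N = 1 and covers only n
    >= 2; the first term is restored here.\<close>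
  then have "(\<lambda>n. harm n / (real n)\<^sup>2) summable_on {1} \<union> {Suc 1..}"
    by (intro summable_on_Un_disjoint) auto
  moreover have "{1} \<union> {Suc 1..} = {1::nat..}" by auto
  ultimately show ?thesis by simp
qed

section \<open>Euler's evaluation of the sum of H_n / n^2\<close>

text \<open>Raising \<open>n\<close> by one adds a series that telescopes to 1 / (n + 1).\<close>

lemma sums_harm_telescope: "(\<lambda>k. 1 / real (Suc k) - 1 / real (Suc k + n)) sums harm n"
proof (induction n)
  case 0
  then show ?case by (simp add: harm_expand)
next
  case (Suc n)
  have "(\<lambda>k. 1 / real (k + Suc n) - 1 / real (Suc k + Suc n)) sums (1 / real (0 + Suc n) - 0)"
  proof (rule telescope_sums')
    show "(\<lambda>k. 1 / real (k + Suc n)) \<longlonglongrightarrow> 0"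
      using LIMSEQ_ignore_initial_segment[OF lim_1_over_n[where 'a = real], of "Suc n"] by (simp add: add_ac)
  qed
  from sums_add[OF Suc this] show ?case
    by (simp add: harm_Suc inverse_eq_divide add_ac)
qed

text \<open>Partial fractions: 1 / (n k (n + k)) = (1 / k - 1 / (n + k)) / n^2.\<close>

lemma has_sum_tornheim_inner:
  assumes "n \<ge> 1"
  shows "((\<lambda>k. 1 / (real n * real k * real (n + k))) has_sum harm n / (real n)\<^sup>2) {1..}"
proof -
  have "((\<lambda>k. 1 / real (Suc k) - 1 / real (Suc k + n)) has_sum harm n) UNIV"
    by (intro sums_nonneg_imp_has_sum sums_harm_telescope) (simp add: frac_le)
  then have "((\<lambda>k. 1 / real k - 1 / real (k + n)) has_sum harm n) {1..}"
    by (subst has_sum_reindex_bij_witness[of "{1..}" Suc "\<lambda>k. k - 1" UNIV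
          "\<lambda>k. 1 / real (Suc k) - 1 / real (Suc k + n)" _ _ "harm n"]) auto
  then have "((\<lambda>k. (1 / real k - 1 / real (k + n)) / (real n)\<^sup>2) has_sum harm n / (real n)\<^sup>2) {1..}"
    unfolding divide_inverse[of _ "(real n)\<^sup>2"] by (rule has_sum_cmult_left)
  then show ?thesis
    by (rule has_sum_cong[THEN iffD1, rotated]) (use assms in \<open>auto simp: divide_simps power2_eq_square\<close>)
qed

(* Sum 1 / (n k (n + k)) over all pairs.  Over k first it gives H_n / n^2; splitting it as
   1 / (n (n + k)^2) + 1 / (k (n + k)^2) and collecting n + k = m gives twice the sum of (H_m - 1 / m) / m^2. *)
lemma euler_sum:
  "((\<lambda>n. harm n / (real n)\<^sup>2) has_sum 2 * (\<Sum>\<^sub>\<infinity>n\<in>{1..}. 1 / real n ^ 3)) {1..}"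
proof -
  define S Z where "S = (\<Sum>\<^sub>\<infinity>n\<in>{1..}. harm n / (real n)\<^sup>2)"
    and "Z = (\<Sum>\<^sub>\<infinity>n\<in>{1..}. 1 / real n ^ 3)"
  define P :: "(nat \<times> nat) set" where "P = {1..} \<times> {1..}"
  define t where "t = (\<lambda>(n, k). 1 / (real n * real k * real (n + k)))"
  define u where "u = (\<lambda>(n, k). 1 / (real n * (real (n + k))\<^sup>2))"
  have S: "((\<lambda>n. harm n / (real n)\<^sup>2) has_sum S) {1..}"
    unfolding S_def using summable_on_harm_over_square by (rule has_sum_infsum)
  have Z: "((\<lambda>n. 1 / real n ^ 3) has_sum Z) {1..}"
    unfolding Z_def using summable_on_inverse_cube by (rule has_sum_infsum)
  have t_inner: "((\<lambda>k. t (n, k)) has_sum harm n / (real n)\<^sup>2) {1..}" if "n \<in> {1..}" for n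
    using has_sum_tornheim_inner[of n] that by (simp add: t_def)
  \<comment> \<open>Row sums give the sum over \<open>P\<close> only once summability on
    \<open>P\<close> is known; for nonnegative terms it follows from summability of the row
    sums.\<close>
  have t_summable: "t summable_on P"
    unfolding P_def using summable_on_harm_over_square
    by (intro summable_on_SigmaI[OF t_inner]) (auto simp: t_def)
  have t: "(t has_sum S) P"
    unfolding P_def by (rule has_sum_SigmaI[OF t_inner S t_summable[unfolded P_def]])
  have "u summable_on P"
    using t_summable
  proof (rule summable_on_comparison_test)
    fix x assume "x \<in> P"
    then obtain n k where x: "x = (n, k)" "n \<ge> 1" "k \<ge> 1" by (auto simp: P_def)
    have "real n * real k * real (n + k) \<le> real n * real (n + k) * real (n + k)"
      by (intro mult_right_mono mult_left_mono) auto
    with x show "u x \<le> t x"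
      by (auto simp: u_def t_def power2_eq_square mult.assoc intro!: divide_left_mono mult_pos_pos)
  qed (auto simp: u_def)
  then obtain U where u: "(u has_sum U) P"
    by (auto simp: summable_on_def)
  then have u_swap: "((\<lambda>(n, k). u (k, n)) has_sum U) P"
    by (subst has_sum_reindex_bij_witness[of P "\<lambda>(n, k). (k, n)" "\<lambda>(n, k). (k, n)" P u _ _ U])
      (auto simp: P_def)
  \<comment> \<open>Since 1 / (n k) = (1 / n + 1 / k) / (n + k), \<open>t\<close> is
    \<open>u\<close> plus its mirror image, and both have sum \<open>U\<close>.\<close>
  have "(t has_sum U + U) P"
    by (rule has_sum_cong[THEN iffD1, OF _ has_sum_add[OF u u_swap]])
      (auto simp: P_def t_def u_def divide_simps power2_eq_square, auto simp: algebra_simps)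
  with t have SU: "S = U + U" by (rule has_sum_unique)
  \<comment> \<open>Collect by m = n + k. The fibre over m = 1 is empty, in agreement with H_1 - 1 =
    0; in general the fibre sum is H_(m-1) / m^2.\<close>
  have reindexed: "((\<lambda>(m, n). 1 / (real n * (real m)\<^sup>2)) has_sum U) (SIGMA m:{1..}. {1..<m})"
    using u by (subst has_sum_reindex_bij_witness[of _ "\<lambda>(n, k). (n + k, n)" "\<lambda>(m, n). (n, m - n)" P u _ _ U])
      (auto simp: P_def u_def)
  have fibre: "((\<lambda>n. 1 / (real n * (real m)\<^sup>2)) has_sum harm m / (real m)\<^sup>2 - 1 / real m ^ 3) {1..<m}"
    if "m \<in> {1..}" for m
  proof (rule has_sum_finiteI)
    obtain j where m: "m = Suc j" using \<open>m \<in> {1..}\<close> by (cases m) auto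
    have "{1..<m} = {1..j}" using m by auto
    then have "(\<Sum>n\<in>{1..<m}. 1 / (real n * (real m)\<^sup>2)) = harm j / (real m)\<^sup>2"
      by (simp add: harm_def divide_inverse sum_distrib_right)
    then show "harm m / (real m)\<^sup>2 - 1 / real m ^ 3 = (\<Sum>n\<in>{1..<m}. 1 / (real n * (real m)\<^sup>2))"
      unfolding m by (simp add: harm_Suc inverse_eq_divide add_divide_distrib power2_eq_square power3_eq_cube)
  qed simp
  have "((\<lambda>m. harm m / (real m)\<^sup>2 - 1 / real m ^ 3) has_sum U) {1..}"
    by (rule has_sum_SigmaD[OF reindexed]) (use fibre in simp)
  from has_sum_add[OF this Z] have "((\<lambda>m. harm m / (real m)\<^sup>2) has_sum U + Z) {1..}"
    by simp
  \<comment> \<open>Together with S = 2 U this forces U = Z.\<close>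
  with S have "S = U + Z" by (rule has_sum_unique)
  with SU have "S = 2 * Z" by simp
  with S show ?thesis unfolding Z_def by simp
qed

section \<open>The constant 2\<close>

lemma has_sum_coprime_harm: "((\<lambda>b. coprime_harm b / (real b)\<^sup>2) has_sum 2) {1..}"
proof -
  define Z where "Z = (\<Sum>\<^sub>\<infinity>n\<in>{1..}. 1 / real n ^ 3)"
  have Z: "((\<lambda>n. 1 / real n ^ 3) has_sum Z) {1..}"
    unfolding Z_def using summable_on_inverse_cube by (rule has_sum_infsum)
  \<comment> \<open>The first term shows that \<open>Z\<close>, which is zeta(3), is positive, so it
    can be cancelled from Z * C = 2 * Z at the end.\<close>
  have "1 / real 1 ^ 3 \<le> Z"
    using finite_sum_le_has_sum[OF Z, of "{1}"] by simp
  then have "Z > 0" by simp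
  define g where "g = (\<lambda>b. coprime_harm b / (real b)\<^sup>2)"
  have "g summable_on {1..}"
    using summable_on_harm_over_square unfolding g_def
    by (rule summable_on_comparison_test)
      (auto intro!: divide_right_mono coprime_harm_le_harm divide_nonneg_nonneg coprime_harm_nonneg)
  then obtain C where C: "(g has_sum C) {1..}"
    by (auto simp: summable_on_def)
  have g_nonneg: "g b \<ge> 0" for b
    by (auto simp: g_def intro!: divide_nonneg_nonneg coprime_harm_nonneg)
  \<comment> \<open>The double sum of \<open>f\<close> factors as Z * C. For n = d * b the term is
    also \<open>coprime_harm b / d\<close> divided by n^2, so the terms with product
    \<open>n\<close> add up to H_n / n^2 by \<open>harm_eq_sum_divisors\<close>.\<close>
  define f where "f = (\<lambda>(d, b). 1 / real d ^ 3 * g b)"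
  have inner: "((\<lambda>b. f (d, b)) has_sum 1 / real d ^ 3 * C) {1..}" for d
    unfolding f_def using has_sum_cmult_right[OF C, of "1 / real d ^ 3"] by simp
  have outer: "((\<lambda>d. 1 / real d ^ 3 * C) has_sum Z * C) {1..}"
    using Z by (rule has_sum_cmult_left)
  have "f summable_on {1..} \<times> {1..}"
    by (rule summable_on_SigmaI[OF inner has_sum_imp_summable[OF outer]]) (auto simp: f_def g_nonneg)
  then have "(f has_sum Z * C) ({1..} \<times> {1..})"
    by (rule has_sum_SigmaI[OF inner outer])
  then have reindexed: "((\<lambda>(n, d). f (d, n div d)) has_sum Z * C) (SIGMA n:{1..}. {d. d dvd n})"
    by (subst has_sum_reindex_bij_witness[of _ "\<lambda>(d, b). (d * b, d)" "\<lambda>(n, d). (d, n div d)"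
          "{1..} \<times> {1..}" f _ _ "Z * C"])
      (auto simp: Suc_le_eq div_greater_zero_iff dvd_imp_le dvd_pos_nat)
  have fibre: "((\<lambda>d. f (d, n div d)) has_sum harm n / (real n)\<^sup>2) {d. d dvd n}"
    if "n \<in> {1..}" for n
  proof (rule has_sum_finiteI)
    show "finite {d. d dvd n}" using that by simp
    have "harm n / (real n)\<^sup>2 = (\<Sum>d | d dvd n. coprime_harm (n div d) / real d / (real n)\<^sup>2)"
      using that by (simp add: harm_eq_sum_divisors sum_divide_distrib)
    also have "\<dots> = (\<Sum>d | d dvd n. f (d, n div d))"
    proof (intro sum.cong refl, clarify)
      fix d assume "d dvd n"
      then obtain b where "n = d * b" by auto
      with that show "coprime_harm (n div d) / real d / (real n)\<^sup>2 = f (d, n div d)"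
        by (auto simp: f_def g_def power2_eq_square power3_eq_cube)
    qed
    finally show "harm n / (real n)\<^sup>2 = (\<Sum>d | d dvd n. f (d, n div d))" .
  qed
  have "((\<lambda>n. harm n / (real n)\<^sup>2) has_sum Z * C) {1..}"
    by (rule has_sum_SigmaD[OF reindexed]) (use fibre in simp)
  moreover have "((\<lambda>n. harm n / (real n)\<^sup>2) has_sum 2 * Z) {1..}"
    unfolding Z_def by (rule euler_sum)
  ultimately have "Z * C = 2 * Z" by (rule has_sum_unique)
  with \<open>Z > 0\<close> C show ?thesis by (simp add: g_def)
qed


section \<open>Error estimates and the asymptotic formulas\<close>

text \<open>H_n - ln n is decreasing and equals 1 at n = 1.\<close>

lemma harm_le_one_plus_ln:
  assumes "n \<ge> 1"
  shows "harm n \<le> 1 + ln (real n)"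
proof -
  obtain j where "n = Suc j" using assms by (cases n) auto
  with decseqD[OF decseq_harm_diff_ln, of 0 j] show ?thesis by (simp add: harm_expand)
qed

text \<open>Two errors arise. Replacing floor(N / b) by N / b costs at most \<open>E\<close>, which
  is at most H_N^2; completing the partial sum \<open>A\<close> to 2 costs \<open>N\<close> times
  the tail, at most H_N + 2.\<close>

lemma sum_F_bound:
  assumes "N \<ge> 1"
  shows "\<bar>(\<Sum>n=1..N. F n) - 2 * real N\<bar> \<le> (harm N)\<^sup>2 + harm N + 2"
proof -
  define A E where "A = (\<Sum>b=1..N. coprime_harm b / (real b)\<^sup>2)"
    and "E = (\<Sum>b=1..N. coprime_harm b / real b)"
  have split: "{1..} - {1..N} = {Suc N..}" using assms by auto
  have tail: "((\<lambda>b. coprime_harm b / (real b)\<^sup>2) has_sum 2 - A) {Suc N..}"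
    using has_sum_Diff[OF has_sum_coprime_harm has_sum_finite[of "{1..N}"]] split
    by (simp add: A_def)
  have "2 - A \<ge> 0"
    using tail by (rule has_sum_nonneg) (simp add: coprime_harm_nonneg)
  moreover have "2 - A \<le> (harm N + 2) / real N"
    using tail
  proof (rule has_sum_le_finite_sums)
    fix X assume X: "finite X" "X \<subseteq> {Suc N..}"
    have "(\<Sum>b\<in>X. coprime_harm b / (real b)\<^sup>2) \<le> (\<Sum>b\<in>X. harm b / (real b)\<^sup>2)"
      by (intro sum_mono divide_right_mono coprime_harm_le_harm) simp
    also have "\<dots> \<le> (harm N + 2) / real N"
      using X assms by (rule sum_harm_over_square_bounded)
    finally show "(\<Sum>b\<in>X. coprime_harm b / (real b)\<^sup>2) \<le> (harm N + 2) / real N" .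
  qed
  ultimately have A: "0 \<le> 2 * real N - real N * A" "2 * real N - real N * A \<le> harm N + 2"
    using assms by (simp_all add: field_simps)
  have NA: "real N * A = (\<Sum>b=1..N. coprime_harm b / real b * (real N / real b))"
    unfolding A_def sum_distrib_left by (simp add: power2_eq_square mult_ac)
  have upper: "(\<Sum>n=1..N. F n) \<le> real N * A"
    unfolding NA sum_F_eq
    by (intro sum_mono mult_left_mono of_nat_div_le_of_nat divide_nonneg_nonneg coprime_harm_nonneg) simp
  have "real N * A - E = (\<Sum>b=1..N. coprime_harm b / real b * (real N / real b - 1))"
    unfolding NA E_def sum_subtractf[symmetric] by (simp add: right_diff_distrib)
  also have "\<dots> \<le> (\<Sum>n=1..N. F n)"
    unfolding sum_F_eq
  proof (intro sum_mono mult_left_mono divide_nonneg_nonneg coprime_harm_nonneg)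
    show "real N / real b - 1 \<le> real (N div b)" for b
      using floor_divide_of_nat_eq[of N b, where ?'a = real] floor_correct[of "real N / real b"] by simp
  qed simp
  finally have lower: "real N * A - E \<le> (\<Sum>n=1..N. F n)" .
  \<comment> \<open>Here \<open>coprime_harm b\<close> \<le> H_b \<le> H_N, and the remaining sum of
    1 / b is H_N once more.\<close>
  have "E \<le> (\<Sum>b=1..N. harm N * inverse (real b))"
    unfolding E_def divide_inverse
    by (intro sum_mono mult_right_mono order_trans[OF coprime_harm_le_harm] harm_mono) auto
  also have "\<dots> = (harm N)\<^sup>2"
    by (simp add: harm_def power2_eq_square flip: sum_distrib_left)
  finally have "E \<le> (harm N)\<^sup>2" .
  moreover have "harm N \<ge> (0 :: real)" by (rule harm_nonneg)
  ultimately show ?thesis using A upper lower by (simp add: abs_le_iff)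
qed

text \<open>Enlarging the square by one adds a row and a column of equal sum \<open>s\<close> and
  the corner 1. As \<open>F (Suc N) = s + 1\<close>, the increment is
  \<open>2 * F (Suc N) - 1\<close>.\<close>

lemma sum_pairs_eq:
  "(\<Sum>m=1..N. \<Sum>n=1..N. real (gcd m n) / real (lcm m n)) = 2 * (\<Sum>n=1..N. F n) - real N"
proof (induction N)
  case (Suc N)
  define s where "s = (\<Sum>k=1..N. real (gcd k (Suc N)) / real (lcm k (Suc N)))"
  have s': "s = (\<Sum>k=1..N. real (gcd (Suc N) k) / real (lcm (Suc N) k))"
    unfolding s_def by (simp only: gcd.commute lcm.commute)
  have "F (Suc N) = s + 1"
    by (simp add: F_def s_def)
  moreover have "(\<Sum>m=1..Suc N. \<Sum>n=1..Suc N. real (gcd m n) / real (lcm m n)) =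
      (\<Sum>m=1..N. \<Sum>n=1..N. real (gcd m n) / real (lcm m n)) + s + s + 1"
    using s' by (simp add: sum.distrib s_def)
  ultimately show ?case using Suc.IH by simp
qed simp

theorem theorem6:
  shows "(\<lambda>x::real. (\<Sum>n\<in>{n::nat. 0 < n \<and> real n \<le> x}. F n) - 2 * x)
           \<in> O[at_top](\<lambda>x. (ln x)\<^sup>2)
       \<and> (\<lambda>x::real. (\<Sum>(m, n)\<in>{(m, n). 0 < m \<and> real m \<le> x \<and> 0 < n \<and> real n \<le> x}.
             real (gcd m n) / real (lcm m n)) - 3 * x)
           \<in> O[at_top](\<lambda>x. (ln x)\<^sup>2)"
proof -
  define T where "T = (\<lambda>x::real. \<Sum>n\<in>{n::nat. 0 < n \<and> real n \<le> x}. F n)"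
  define D where "D = (\<lambda>x::real. \<Sum>(m, n)\<in>{(m, n). 0 < m \<and> real m \<le> x \<and> 0 < n \<and> real n \<le> x}.
             real (gcd m n) / real (lcm m n))"
  \<comment> \<open>The threshold \<open>exp 1\<close> gives ln x >= 1, so lower powers of ln x and
    constants are absorbed into (ln x)^2.\<close>
  have bounds: "\<bar>T x - 2 * x\<bar> \<le> 10 * (ln x)\<^sup>2 \<and> \<bar>D x - 3 * x\<bar> \<le> 19 * (ln x)\<^sup>2"
    if x: "x \<ge> exp 1" for x
  proof -
    define N where "N = nat \<lfloor>x\<rfloor>"
    have "x \<ge> 1" using x exp_ge_add_one_self[of 1] by linarith
    then have N: "N \<ge> 1" "real N \<le> x" "x < real N + 1"
      by (auto simp: N_def le_nat_iff le_floor_iff)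
    have Nset: "{n. 0 < n \<and> real n \<le> x} = {1..N}"
      using \<open>x \<ge> 1\<close> by (auto simp: N_def le_nat_iff le_floor_iff)
    have T: "T x = (\<Sum>n=1..N. F n)"
      unfolding T_def Nset ..
    have "{(m, n). 0 < m \<and> real m \<le> x \<and> 0 < n \<and> real n \<le> x} = {1..N} \<times> {1..N}"
      using Nset by auto
    then have D: "D x = 2 * T x - real N"
      unfolding D_def T by (simp only: sum.cartesian_product[symmetric] sum_pairs_eq)
    have L: "ln x \<ge> 1" using x \<open>x \<ge> 1\<close> by (simp add: ln_ge_iff)
    have "harm N \<le> 1 + ln (real N)" using N(1) by (rule harm_le_one_plus_ln)
    also have "\<dots> \<le> 1 + ln x" using N by simp
    also have "\<dots> \<le> 2 * ln x" using L by simp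
    finally have H: "harm N \<le> 2 * ln x" .
    then have "(harm N)\<^sup>2 \<le> (2 * ln x)\<^sup>2"
      by (intro power_mono harm_nonneg)
    moreover have "ln x \<le> (ln x)\<^sup>2" "1 \<le> (ln x)\<^sup>2"
      using L by (simp_all add: power2_eq_square mult_left_le_imp_le one_le_power[of _ 2, unfolded power2_eq_square])
    moreover have "\<bar>T x - 2 * real N\<bar> \<le> (harm N)\<^sup>2 + harm N + 2"
      unfolding T using N(1) by (rule sum_F_bound)
    \<comment> \<open>With L = ln x, H_N \<le> 2 L gives 4 L^2 + 2 L + 2 \<le> 8 L^2. Passing from
      \<open>N\<close> to \<open>x\<close> costs at most 2 for \<open>T\<close>, hence 10; for
      \<open>D\<close> the error doubles to 16 and the passage costs at most 3, hence 19.\<close>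
    ultimately have "\<bar>T x - 2 * real N\<bar> \<le> 8 * (ln x)\<^sup>2" "1 \<le> (ln x)\<^sup>2"
      using H by (simp_all add: power_mult_distrib)
    with N D show ?thesis by (simp add: abs_le_iff)
  qed
  have "(\<lambda>x. T x - 2 * x) \<in> O[at_top](\<lambda>x. (ln x)\<^sup>2)"
    by (rule bigoI[of _ 10], rule eventually_mono[OF eventually_ge_at_top[of "exp 1"]])
      (use bounds in simp)
  moreover have "(\<lambda>x. D x - 3 * x) \<in> O[at_top](\<lambda>x. (ln x)\<^sup>2)"
    by (rule bigoI[of _ 19], rule eventually_mono[OF eventually_ge_at_top[of "exp 1"]])
      (use bounds in simp)
  ultimately show ?thesis unfolding T_def D_def by (rule conjI)
qed

end
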